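(* Fix $k\in\mathbb{N}$. Suppose that for every $n\in\mathbb{N}$ we are given a deterministic adaptive query procedure on $[n]$, i.e., functions $\mathsf{Pair}_i:(\binom{[n]}{2}\times[0,\infty))^{i-1}\to\binom{[n]}{2}$ for $i=1,\ldots,m(n)$, where $m(n)=o(n^{(k+1)/k})$ as $n\to\infty$. Then for every $n$ there exist answers to the queries, namely a sequence of pairs $\{a_1,b_1\},\ldots,\{a_{m},b_{m}\}$ ($m=m(n)$) and values $w(a_i,b_i)\in\{1,\ldots,k\}$ with $\{a_i,b_i\}=\mathsf{Pair}_i\big((\{a_1,b_1\},w(a_1,b_1)),\ldots,(\{a_{i-1},b_{i-1}\},w(a_{i-1},b_{i-1}))\big)$ for all $i$, together with two metrics $\overline{d},\underline{d}:[n]\times[n]\to[0,k+1]$ on $[n]$, such that, writing $E=\{\{a_i,b_i\}:i\le m\}$: (a) $\overline{d}(u,v)=\underline{d}(u,v)=w(u,v)$ for every $\{u,v\}\in E$; (b) $\overline{d}(x,y)=k+1$ for all $(x,y)\in([n]\times[n])\setminus X_n$ for some $X_n\subseteq[n]\times[n]$ with $|X_n|=o(n^2)$; (c) $\underline{d}(x,y)=\tfrac12$ for all $(x,y)\in([n]\times[n])\setminus Y_n$ for some $Y_n\subseteq[n]\times[n]$ with $|Y_n|=o(n^2)$, where the $o(\cdot)$ are as $n\to\infty$.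
   Context: $[n]=\{1,\ldots,n\}$ and $\binom{[n]}{2}$ is the set of unordered pairs of distinct elements of $[n]$. $\mathsf{Pair}_1$ is a fixed pair (a function of no arguments). The procedure is adaptive: each queried pair is a function of the previously queried pairs and the answers received. *)

theory Defs
  imports "HOL-Analysis.Abstract_Metric_Spaces" "HOL-Library.Landau_Symbols" "HOL-Library.Ramsey"
begin

abbreviation pairs_of :: "nat \<Rightarrow> nat set set" where
  "pairs_of n \<equiv> nsets {1..n} 2"

text \<open>
  The functions \<open>query i\<close> for \<open>i = 1, \<dots>, m\<close>. The sequences of length \<open>i - 1\<close> in the domain are
  arbitrary: they need not arise from an actual run, and may assign different values to the same
  pair. Nothing is required of \<open>query i\<close> outside this domain or for \<open>i\<close> outside \<open>{1..m}\<close>.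
\<close>

definition query_procedure ::
  "nat \<Rightarrow> nat \<Rightarrow> (nat \<Rightarrow> (nat set \<times> real) list \<Rightarrow> nat set) \<Rightarrow> bool" where
  "query_procedure n m query \<longleftrightarrow>
     (\<forall>i\<in>{1..m}. query i \<in> {h. length h = i - 1 \<and> set h \<subseteq> pairs_of n \<times> {0..}} \<rightarrow> pairs_of n)"

text \<open>
  \<open>e i\<close> is the pair \<open>{a\<^sub>i, b\<^sub>i}\<close>. The answer \<open>w\<close> is a function of the unordered pair, so a pair
  that is queried again receives the same answer.
\<close>

definition history :: "(nat \<Rightarrow> nat set) \<Rightarrow> (nat set \<Rightarrow> nat) \<Rightarrow> nat \<Rightarrow> (nat set \<times> real) list" where
  "history e w i = map (\<lambda>j. (e j, real (w (e j)))) [1..<i]"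

definition query_run ::
  "nat \<Rightarrow> nat \<Rightarrow> (nat \<Rightarrow> (nat set \<times> real) list \<Rightarrow> nat set) \<Rightarrow>
   (nat \<Rightarrow> nat set) \<Rightarrow> (nat set \<Rightarrow> nat) \<Rightarrow> bool" where
  "query_run k m query e w \<longleftrightarrow>
     (\<forall>i\<in>{1..m}. e i = query i (history e w i) \<and> w (e i) \<in> {1..k})"

definition metric_upto :: "nat \<Rightarrow> real \<Rightarrow> (nat \<Rightarrow> nat \<Rightarrow> real) \<Rightarrow> bool" where
  "metric_upto n r d \<longleftrightarrow>
     Metric_space {1..n} d \<and> (\<forall>x\<in>{1..n}. \<forall>y\<in>{1..n}. d x y \<in> {0..r})"

end

theory Submission
  imports Defs
begin

text \<open>
  The adversary maintains an integer metric \<open>d\<close>, initially \<open>k + 1\<close> off the diagonal, and a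
  parameter \<open>D\<close> with \<open>m = o(n D)\<close> and \<open>D ^ k = o(n)\<close>. The level of a vertex \<open>u\<close> is one more than the
  largest \<open>l < k\<close> for which \<open>u\<close> already has \<open>D ^ l\<close> edges of weight \<open>l\<close>, and \<open>L\<close> is the least
  function above the levels that is \<open>1\<close>-Lipschitz for \<open>d\<close>. A queried pair \<open>{u, v}\<close> is answered by
  \<open>min (d u v) (max (L u) (L v))\<close>, and \<open>d\<close> is shortened along the new edge. Since \<open>L\<close> is Lipschitz
  and grows with time, this never shortens an earlier edge.

  The degree caps bound a \<open>d\<close>-ball of radius \<open>i < k\<close> by \<open>(2 D) ^ i\<close>, so \<open>d = k + 1\<close> almost everywhere.
  A vertex of level \<open>l\<close> consumes \<open>D ^ (l - 1)\<close> edges, so \<open>L \<ge> 2\<close> at only \<open>O(m / D) = o(n)\<close> vertices.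
  The lower metric is the minimum of \<open>d\<close> and the maximum of \<open>max (L x) (L y) - 1/2\<close> and the lower
  bound \<open>w(u, v) - d u x - d v y\<close> that the answers \<open>w\<close> force on the distance of \<open>x\<close> and \<open>y\<close>.
\<close>

section \<open>Unordered pairs and a power identity\<close>

text \<open>Answers are indexed by unordered pairs, while metrics take two arguments.
  \<open>Min\<close> and \<open>Max\<close> pick an order of the endpoints, which is immaterial for
  symmetric \<open>d\<close>.\<close>

definition pair_dist :: "(nat \<Rightarrow> nat \<Rightarrow> 'a) \<Rightarrow> nat set \<Rightarrow> 'a" where
  "pair_dist d p = d (Min p) (Max p)"

lemma pair_dist_insert: "(\<And>x y. d x y = d y x) \<Longrightarrow> pair_dist d {u, v} = d u v"
  unfolding pair_dist_def by (cases "u \<le> v") (auto simp: min_def max_def)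

lemma card_ordered_pairs_le:
  fixes F :: "nat set set"
  assumes "finite F"
  shows "finite {(u, v). {u, v} \<in> F}" and "card {(u, v). {u, v} \<in> F} \<le> 2 * card F"
proof -
  have sub: "{(u, v). {u, v} \<in> F} \<subseteq> (\<lambda>p. (Min p, Max p)) ` F \<union> (\<lambda>p. (Max p, Min p)) ` F"
  proof (safe)
    fix u v assume F: "{u, v} \<in> F" and "(u, v) \<notin> (\<lambda>p. (Max p, Min p)) ` F"
    then have "(u, v) \<noteq> (Max {u, v}, Min {u, v})" by blast
    then have "(u, v) = (Min {u, v}, Max {u, v})" by (auto simp: min_def max_def split: if_splits)
    then show "(u, v) \<in> (\<lambda>p. (Min p, Max p)) ` F" using F by blast
  qed
  show "finite {(u, v). {u, v} \<in> F}" using sub assms by (meson finite_UnI finite_imageI finite_subset)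
  have "card {(u, v). {u, v} \<in> F} \<le> card ((\<lambda>p. (Min p, Max p)) ` F \<union> (\<lambda>p. (Max p, Min p)) ` F)"
    using sub assms by (intro card_mono) auto
  also have "\<dots> \<le> card F + card F"
    by (rule order_trans[OF card_Un_le]) (intro add_mono card_image_le assms)
  finally show "card {(u, v). {u, v} \<in> F} \<le> 2 * card F" by simp
qed

text \<open>Divided by \<open>D ^ i\<close> this is a geometric sum of powers of 2. It says that
  \<open>(2 * D) ^ i\<close> solves the recursion for ball sizes in which each point has up to
  \<open>D ^ l\<close> edges of every length \<open>l\<close>.\<close>

lemma sum_power_eq:
  fixes D :: nat
  shows "D ^ i + (\<Sum>l=1..i. D ^ l * (2 * D) ^ (i - l)) = (2 * D) ^ i"
proof (induction i)
  case (Suc i)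
  have *: "(\<Sum>l=1..i. D ^ l * (2 * D) ^ (Suc i - l)) = 2 * D * (\<Sum>l=1..i. D ^ l * (2 * D) ^ (i - l))"
    unfolding sum_distrib_left by (intro sum.cong) (auto simp: Suc_diff_le mult_ac)
  have "(\<Sum>l=1..Suc i. D ^ l * (2 * D) ^ (Suc i - l)) =
        (\<Sum>l=1..i. D ^ l * (2 * D) ^ (Suc i - l)) + D ^ Suc i"
    by simp
  then have "D ^ Suc i + (\<Sum>l=1..Suc i. D ^ l * (2 * D) ^ (Suc i - l)) =
        2 * D * (D ^ i + (\<Sum>l=1..i. D ^ l * (2 * D) ^ (i - l)))"
    unfolding * distrib_left by (simp only: power_Suc mult_2 distrib_right)
  also have "\<dots> = (2 * D) ^ Suc i"
    unfolding Suc.IH by (rule power_Suc[symmetric])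
  finally show ?case .
qed simp

section \<open>Levels and their Lipschitz envelope\<close>

locale query_game =
  fixes k n D :: nat
  assumes k_pos: "1 \<le> k" and D_pos: "1 \<le> D"
begin

definition nbrs :: "(nat \<Rightarrow> nat \<Rightarrow> nat) \<Rightarrow> nat set set \<Rightarrow> nat \<Rightarrow> nat \<Rightarrow> nat set" where
  "nbrs d F u l = {v \<in> {1..n}. {u, v} \<in> F \<and> d u v = l}"

definition saturated :: "(nat \<Rightarrow> nat \<Rightarrow> nat) \<Rightarrow> nat set set \<Rightarrow> nat \<Rightarrow> nat set" where
  "saturated d F u = {l \<in> {1..<k}. D ^ l \<le> card (nbrs d F u l)}"

definition level :: "(nat \<Rightarrow> nat \<Rightarrow> nat) \<Rightarrow> nat set set \<Rightarrow> nat \<Rightarrow> nat" where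
  "level d F u = Max (insert 1 (Suc ` saturated d F u))"

text \<open>The McShane-type envelope of \<open>level\<close>. Truncated subtraction is harmless: if
  \<open>d x x = 0\<close>, the term for \<open>u = x\<close> is already at least 1.\<close>

definition lip_level :: "(nat \<Rightarrow> nat \<Rightarrow> nat) \<Rightarrow> nat set set \<Rightarrow> nat \<Rightarrow> nat" where
  "lip_level d F x = Max ((\<lambda>u. level d F u - d u x) ` {1..n})"

lemma finite_nbrs [simp]: "finite (nbrs d F u l)"
  by (simp add: nbrs_def)

lemma finite_saturated [simp]: "finite (saturated d F u)"
  by (simp add: saturated_def)

lemma level_ge1: "1 \<le> level d F u"
  by (simp add: level_def)

lemma level_le: "level d F u \<le> k"
  using k_pos by (auto simp: level_def saturated_def)

lemma level_gt: "l \<in> saturated d F u \<Longrightarrow> l < level d F u"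
  unfolding level_def by (subst less_eq_Suc_le, rule Max_ge) auto

lemma level_saturated:
  assumes "2 \<le> level d F u"
  shows "level d F u - 1 \<in> saturated d F u"
proof -
  have "level d F u \<in> insert 1 (Suc ` saturated d F u)"
    unfolding level_def by (rule Max_in) auto
  then show ?thesis using assms by auto
qed

lemma level_le_lip_level: "u \<in> {1..n} \<Longrightarrow> level d F u - d u x \<le> lip_level d F x"
  unfolding lip_level_def by (rule Max_ge) auto

lemma lip_level_attained:
  assumes "1 \<le> n" obtains u where "u \<in> {1..n}" "lip_level d F x = level d F u - d u x"
proof -
  have "lip_level d F x \<in> (\<lambda>u. level d F u - d u x) ` {1..n}"
    unfolding lip_level_def using \<open>1 \<le> n\<close> by (intro Max_in) auto
  then show ?thesis using that by blast
qed

lemma lip_level_le: "1 \<le> n \<Longrightarrow> lip_level d F x \<le> k"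
  using level_le by (metis diff_le_self le_trans lip_level_attained)

lemma lip_level_ge1:
  assumes "d x x = 0" "x \<in> {1..n}"
  shows "1 \<le> lip_level d F x"
  using level_le_lip_level[of x d F x] level_ge1[of d F x] assms by simp

lemma lip_level_lipschitz:
  assumes "1 \<le> n" "\<And>x y z. d x z \<le> d x y + d y z"
  shows "lip_level d F x \<le> lip_level d F y + d x y"
proof -
  obtain u where u: "u \<in> {1..n}" "lip_level d F x = level d F u - d u x"
    using lip_level_attained[OF assms(1)] by blast
  have "d u y \<le> d u x + d x y" by (rule assms)
  with u level_le_lip_level[of u d F y] show ?thesis by linarith
qed

text \<open>During the game distances fall and levels rise. Both enlarge every term of the maximum,
  so bounds by \<open>lip_level\<close> on earlier answers survive.\<close>

lemma lip_level_mono: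
  assumes "1 \<le> n" "\<And>x y. d' x y \<le> d x y" "\<And>u. level d F u \<le> level d' F' u"
  shows "lip_level d F x \<le> lip_level d' F' x"
proof -
  obtain u where u: "u \<in> {1..n}" "lip_level d F x = level d F u - d u x"
    using lip_level_attained[OF assms(1)] by blast
  have "level d F u - d u x \<le> level d' F' u - d' u x"
    using assms(2)[of u x] assms(3)[of u] by linarith
  with u level_le_lip_level[of u d' F' x] show ?thesis by linarith
qed

lemma level_mono:
  assumes "\<And>l. nbrs d F u l \<subseteq> nbrs d' F' u l"
  shows "level d F u \<le> level d' F' u"
proof -
  have "D ^ l \<le> card (nbrs d' F' u l)" if "D ^ l \<le> card (nbrs d F u l)" for l
    by (rule order_trans[OF that card_mono[OF finite_nbrs assms]])
  then have "saturated d F u \<subseteq> saturated d' F' u"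
    unfolding saturated_def by blast
  then show ?thesis unfolding level_def by (intro Max_mono) auto
qed

end

section \<open>The invariant and one move of the adversary\<close>

text \<open>
  \<open>E\<close> consists of the queried pairs. \<open>F\<close> contains only those whose answer was smaller than the
  distance at that time: they alone generate \<open>d\<close>, and only they count towards the levels.
\<close>

locale game_state = query_game +
  fixes d :: "nat \<Rightarrow> nat \<Rightarrow> nat" and F E :: "nat set set"
  assumes sym: "d x y = d y x" and zero: "d x y = 0 \<longleftrightarrow> x = y" and tri: "d x z \<le> d x y + d y z"
    and bnd: "d x y \<le> k + 1"
    and FE: "F \<subseteq> E" and EV: "E \<subseteq> pairs_of n"
    and path: "x \<noteq> y \<Longrightarrow> d x y \<le> k \<Longrightarrow> \<exists>z. {z, y} \<in> F \<and> d x z + d z y \<le> d x y"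
    and deg: "l \<in> {1..<k} \<Longrightarrow> card (nbrs d F a l) \<le> D ^ l"
    and EL: "{a, b} \<in> E \<Longrightarrow> d a b \<le> max (lip_level d F a) (lip_level d F b)"
begin

text \<open>The answer to the new pair is \<open>pair_dist d' {u, v}\<close>; the last conjunct is
  what freezes answers in later moves. If \<open>d u v\<close> is at most \<open>w\<close>, nothing
  but \<open>E\<close> changes, and \<open>EL\<close> for the new pair is the case assumption; by
  \<open>EL\<close>, a repeated query lands here. Otherwise an edge of length \<open>w\<close> is
  inserted.\<close>

lemma step:
  assumes uv: "{u, v} \<in> pairs_of n"
  shows "\<exists>d' F'. game_state k n D d' F' (insert {u, v} E) \<and> F' \<subseteq> insert {u, v} F \<and>
           (\<forall>p\<in>E. pair_dist d' p = pair_dist d p)"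
proof -
  let ?L = "lip_level d F"
  have uv': "u \<in> {1..n}" "v \<in> {1..n}" "u \<noteq> v" 
    using uv by (auto simp: nsets_def card_insert_if split: if_splits)
  then have n1: "1 \<le> n" by auto
  define w where "w = max (?L u) (?L v)"
  have w1: "1 \<le> w" using lip_level_ge1[of d u F] uv' zero unfolding w_def by (auto simp: max_def)
  show ?thesis
  proof (cases "d u v \<le> w")
    case True
    have "d a b \<le> max (?L a) (?L b)" if "{a, b} \<in> insert {u, v} E" for a b
      using that True EL sym unfolding w_def by (auto simp: doubleton_eq_iff max.commute)
    then have "game_state k n D d F (insert {u, v} E)"
      using FE EV uv by unfold_locales (use sym zero tri bnd path deg in auto)
    then show ?thesis by blast
  next
    case False
    \<comment> \<open>The shortest-path metric after adding an edge of length \<open>w\<close>; a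
      shortest path crosses it at most once, in one of two directions.\<close>
    define d' where "d' x y = min (d x y) (min (d x u + w + d v y) (d x v + w + d u y))" for x y
    let ?F = "insert {u, v} F"
    have d'_le: "d' x y \<le> d x y" for x y by (simp add: d'_def)
    have sym': "d' x y = d' y x" for x y
      using sym[of x y] sym[of x u] sym[of x v] sym[of u y] sym[of v y]
      unfolding d'_def by (simp add: min.commute add.commute add.left_commute)
    have zero': "d' x y = 0 \<longleftrightarrow> x = y" for x y
      using w1 zero[of x y] by (auto simp: d'_def min_def)
    have tri': "d' x z \<le> d' x y + d' y z" for x y z
    proof -
      note t = tri[of x z y] tri[of x u y] tri[of x v y] tri[of v z y] tri[of u z y] tri[of x z u]
        tri[of x z v] tri[of u v y] tri[of v u y] sym[of u v] sym[of u y] sym[of v y]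
      have le: "d' x z \<le> d x z" "d' x z \<le> d x u + w + d v z" "d' x z \<le> d x v + w + d u z"
        by (auto simp: d'_def)
      have 1: "d' x y = d x y \<or> d' x y = d x u + w + d v y \<or> d' x y = d x v + w + d u y"
        and 2: "d' y z = d y z \<or> d' y z = d y u + w + d v z \<or> d' y z = d y v + w + d u z"
        unfolding d'_def by (auto simp: min_def)
      show ?thesis
        using 1 2 by (elim disjE) (use le t sym[of y u] sym[of y v] in linarith)+
    qed
    \<comment> \<open>A detour from \<open>a\<close> through \<open>u\<close> and \<open>v\<close>
      to \<open>b\<close> costs at least \<open>d a u + w\<close>, which is at least
      \<open>?L a\<close> since \<open>w\<close> dominates \<open>?L u\<close> and \<open>?L\<close>
      is Lipschitz. From the other end it costs at least \<open>?L b\<close>. By \<open>EL\<close>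
      it cannot beat \<open>d a b\<close>.\<close>
    have old: "d' a b = d a b" if "{a, b} \<in> E" for a b
    proof -
      have 1: "?L a \<le> ?L c + d a c" for a c by (rule lip_level_lipschitz[OF n1 tri])
      show ?thesis
        using EL[OF that] 1[of a u] 1[of a v] 1[of b u] 1[of b v] sym[of b u] sym[of b v]
        unfolding d'_def w_def by (auto simp: min_def max_def split: if_splits)
    qed
    have new: "d' u v = w" using False zero[of u u] zero[of v v] w1 unfolding d'_def by (simp add: min_def)
    have uvE: "{u, v} \<notin> E" using old[of u v] new False by auto
    have path': "\<exists>z. {z, y} \<in> ?F \<and> d' x z + d' z y \<le> d' x y" if xy: "x \<noteq> y" "d' x y \<le> k" for x y
    proof -
      \<comment> \<open>The last edge of a path through the new edge is the new edge itself if
        \<open>b = y\<close>. Otherwise it is the last edge of a path from \<open>b\<close> to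
        \<open>y\<close>, which lies in \<open>F\<close> and keeps its length by
        \<open>old\<close>.\<close>
      have via: "\<exists>z. {z, y} \<in> ?F \<and> d' x z + d' z y \<le> d' x y"
        if eq: "d' x y = d x a + w + d b y" and ab: "{a, b} = {u, v}" for a b
      proof -
        have ab': "d' a b = w"
        using ab new sym'[of v u] by (auto simp: doubleton_eq_iff)
      have le: "d' x z \<le> d x a + w + d b z" for z
        using ab by (auto simp: doubleton_eq_iff d'_def)
        show ?thesis
        proof (cases "b = y")
          case True
          then show ?thesis using ab ab' eq zero[of y y] d'_le[of x a] by (intro exI[of _ a]) auto
        next
          case False
          then obtain z where z: "{z, y} \<in> F" "d b z + d z y \<le> d b y"
            using path[of b y] eq \<open>d' x y \<le> k\<close> by auto
          then show ?thesis using old[of z y] FE eq le[of z] by (intro exI[of _ z]) auto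
        qed
      qed
      show ?thesis
      proof (cases "d' x y = d x y")
        case True
        then obtain z where z: "{z, y} \<in> F" "d x z + d z y \<le> d x y"
          using path[of x y] xy by auto
        then show ?thesis using old[of z y] FE True d'_le[of x z] by (intro exI[of _ z]) auto
      next
        case False
        then consider "d' x y = d x u + w + d v y" | "d' x y = d x v + w + d u y"
          unfolding d'_def by linarith
        then show ?thesis using via by cases (auto simp: insert_commute)
      qed
    qed
    have nbrs_old: "nbrs d' F a l = nbrs d F a l" for a l
      using old FE unfolding nbrs_def by auto
    have nbrs_new: "nbrs d' ?F a l = nbrs d F a l" if "a \<noteq> u \<and> a \<noteq> v \<or> l \<noteq> w" for a l
      unfolding nbrs_old[symmetric] using that new sym' unfolding nbrs_def
      by (auto simp: doubleton_eq_iff)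
    have sub: "nbrs d F a l \<subseteq> nbrs d' ?F a l" for a l
      unfolding nbrs_old[symmetric] unfolding nbrs_def by auto
    have deg': "card (nbrs d' ?F a l) \<le> D ^ l" if l: "l \<in> {1..<k}" for a l
    proof (cases "a \<noteq> u \<and> a \<noteq> v \<or> l \<noteq> w")
      case True
      then show ?thesis using nbrs_new deg[OF l] by simp
    next
      case False
      then obtain b where b: "{a, b} = {u, v}" and l': "l = w" by auto
      \<comment> \<open>The answer \<open>w\<close> bounds the level of both endpoints, so weight
        \<open>w\<close> is not yet saturated at \<open>a\<close>: there is room for one more edge
        under the cap.\<close>
      have "a \<in> {1..n}" using False uv' by auto
      then have "level d F a \<le> ?L a" using level_le_lip_level[of a d F a] zero[of a a] by simp
      also have "\<dots> \<le> w" using False unfolding w_def by auto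
      finally have "w \<notin> saturated d F a" using level_gt[of w d F a] by auto
      then have lt: "card (nbrs d F a l) < D ^ l" using l l' unfolding saturated_def by auto
      have "nbrs d' ?F a l \<subseteq> insert b (nbrs d F a l)"
        unfolding nbrs_old[symmetric] using b unfolding nbrs_def by (auto simp: doubleton_eq_iff)
      then have "card (nbrs d' ?F a l) \<le> card (insert b (nbrs d F a l))"
        by (intro card_mono) auto
      also have "\<dots> \<le> Suc (card (nbrs d F a l))" by (rule card_insert_le_m1) auto
      finally show ?thesis using lt by simp
    qed
    have Lmono: "?L x \<le> lip_level d' ?F x" for x
      by (rule lip_level_mono[OF n1 d'_le level_mono[OF sub]])
    have EL': "d' a b \<le> max (lip_level d' ?F a) (lip_level d' ?F b)"
      if "{a, b} \<in> insert {u, v} E" for a b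
    proof (cases "{a, b} \<in> E")
      case True
      then show ?thesis using old[OF True] EL[OF True] Lmono[of a] Lmono[of b] by linarith
    next
      case False
      then have "d' a b = max (?L a) (?L b)" using that new sym' unfolding w_def
        by (auto simp: doubleton_eq_iff max.commute)
      then show ?thesis using Lmono[of a] Lmono[of b] by linarith
    qed
    have "game_state k n D d' ?F (insert {u, v} E)"
    proof
      show "d' x y \<le> k + 1" for x y using d'_le[of x y] bnd[of x y] by simp
      show "?F \<subseteq> insert {u, v} E" "insert {u, v} E \<subseteq> pairs_of n" using FE EV uv by auto
    qed (fact sym' zero' tri' path' deg' EL')+
    moreover have "pair_dist d' p = pair_dist d p" if "p \<in> E" for p
    proof -
      have "card p = 2" using that EV by (auto simp: nsets_def)
      then obtain a b where "p = {a, b}" by (meson card_2_iff)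
      then show ?thesis using old that sym sym' by (simp add: pair_dist_insert)
    qed
    ultimately show ?thesis by blast
  qed
qed

section \<open>Ball sizes, close pairs and vertices of high level\<close>

lemma F_V: "{u, v} \<in> F \<Longrightarrow> u \<in> {1..n} \<and> v \<in> {1..n} \<and> u \<noteq> v"
  using FE EV by (auto simp: nsets_def card_insert_if split: if_splits)

lemma E_V: "{u, v} \<in> E \<Longrightarrow> u \<in> {1..n} \<and> v \<in> {1..n} \<and> u \<noteq> v"
  using EV by (auto simp: nsets_def card_insert_if split: if_splits)

lemma finite_E: "finite E"
  using EV by (rule finite_subset) (simp add: finite_imp_finite_nsets)

lemma finite_F: "finite F"
  using finite_E FE by (rule rev_finite_subset)

lemma E_le: assumes "{u, v} \<in> E" shows "d u v \<le> k"
proof -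
  have "1 \<le> n" using E_V[OF assms] by auto
  then show ?thesis
    using EL[OF assms] lip_level_le[of d F u] lip_level_le[of d F v] by linarith
qed

definition dball :: "nat \<Rightarrow> nat \<Rightarrow> nat set" where
  "dball u i = {x \<in> {1..n}. d u x \<le> i}"

lemma finite_dball [simp]: "finite (dball u i)"
  by (simp add: dball_def)

lemma dball_0: "dball u 0 \<subseteq> {u}"
  by (auto simp: dball_def zero)

text \<open>Split the points other than \<open>u\<close> by the length \<open>l\<close> of the last
  edge that \<open>path\<close> provides. Since \<open>path\<close> speaks only of distances up to
  \<open>k\<close>, so does this recursion.\<close>

lemma card_dball_rec:
  assumes "i \<le> k"
  shows "card (dball u i) \<le> 1 + (\<Sum>l=1..i. \<Sum>z\<in>dball u (i - l). card (nbrs d F z l))"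
proof -
  have "x \<in> (\<Union>l\<in>{1..i}. \<Union>z\<in>dball u (i - l). nbrs d F z l)"
    if x: "x \<in> dball u i" "x \<noteq> u" for x
  proof -
    have le: "x \<in> {1..n}" "d u x \<le> i" using x by (auto simp: dball_def)
    then obtain z where z: "{z, x} \<in> F" "d u z + d z x \<le> d u x"
      using path[of u x] x assms by auto
    note F_V[OF z(1)]
    moreover have "d z x \<noteq> 0" using zero[of z x] F_V[OF z(1)] by simp
    ultimately show ?thesis using z le
      by (intro UN_I[of "d z x"] UN_I[of z]) (auto simp: dball_def nbrs_def)
  qed
  then have "dball u i \<subseteq> insert u (\<Union>l\<in>{1..i}. \<Union>z\<in>dball u (i - l). nbrs d F z l)"
    by blast
  then have "card (dball u i) \<le> card (insert u (\<Union>l\<in>{1..i}. \<Union>z\<in>dball u (i - l). nbrs d F z l))"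
    by (intro card_mono) auto
  also have "\<dots> \<le> 1 + card (\<Union>l\<in>{1..i}. \<Union>z\<in>dball u (i - l). nbrs d F z l)"
    by (rule card_insert_le_m1[THEN order_trans]) auto
  also have "card (\<Union>l\<in>{1..i}. \<Union>z\<in>dball u (i - l). nbrs d F z l)
      \<le> (\<Sum>l=1..i. card (\<Union>z\<in>dball u (i - l). nbrs d F z l))"
    by (rule card_UN_le) simp
  also have "\<dots> \<le> (\<Sum>l=1..i. \<Sum>z\<in>dball u (i - l). card (nbrs d F z l))"
    by (intro sum_mono card_UN_le) simp
  finally show ?thesis by simp
qed

text \<open>For radius below \<open>k\<close> every edge length involved is capped by
  \<open>deg\<close>, and \<open>sum_power_eq\<close> solves the recursion after 1 is enlarged to
  \<open>D ^ i\<close>.\<close>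

lemma card_dball: "i < k \<Longrightarrow> card (dball u i) \<le> (2 * D) ^ i"
proof (induction i rule: less_induct)
  case (less i)
  have "(\<Sum>z\<in>dball u (i - l). card (nbrs d F z l)) \<le> D ^ l * (2 * D) ^ (i - l)"
    if l: "l \<in> {1..i}" for l
  proof -
    have "(\<Sum>z\<in>dball u (i - l). card (nbrs d F z l)) \<le> card (dball u (i - l)) * D ^ l"
      using sum_bounded_above[of "dball u (i - l)" "\<lambda>z. card (nbrs d F z l)" "D ^ l"] deg[of l] l less.prems
      by simp
    also have "\<dots> \<le> (2 * D) ^ (i - l) * D ^ l"
      using less.IH[of "i - l"] less.prems l by (intro mult_right_mono) auto
    finally show ?thesis by (simp add: mult.commute)
  qed
  then have "(\<Sum>l=1..i. \<Sum>z\<in>dball u (i - l). card (nbrs d F z l))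
      \<le> (\<Sum>l=1..i. D ^ l * (2 * D) ^ (i - l))"
    by (rule sum_mono)
  moreover have "1 \<le> D ^ i" using D_pos by simp
  ultimately show ?case
    using card_dball_rec[of i u] less.prems sum_power_eq[of D i] by linarith
qed

text \<open>Weight \<open>k\<close> has no cap. It enters only for \<open>l = k\<close>, where the
  centre set is a ball of radius 0, so just the edges of weight \<open>k\<close> at \<open>u\<close>
  itself are added; these are few on average over \<open>u\<close>.\<close>

lemma card_dball_k: "card (dball u k) \<le> (2 * D) ^ k + card (nbrs d F u k)"
proof -
  have "(\<Sum>z\<in>dball u (k - l). card (nbrs d F z l))
      \<le> D ^ l * (2 * D) ^ (k - l) + (if l = k then card (nbrs d F u k) else 0)"
    if l: "l \<in> {1..k}" for l
  proof (cases "l = k")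
    case True
    have "(\<Sum>z\<in>dball u 0. card (nbrs d F z k)) \<le> (\<Sum>z\<in>{u}. card (nbrs d F z k))"
      by (intro sum_mono2 dball_0) auto
    then show ?thesis using True by simp
  next
    case False
    have "(\<Sum>z\<in>dball u (k - l). card (nbrs d F z l)) \<le> card (dball u (k - l)) * D ^ l"
      using sum_bounded_above[of "dball u (k - l)" "\<lambda>z. card (nbrs d F z l)" "D ^ l"] deg[of l] l False
      by simp
    also have "\<dots> \<le> (2 * D) ^ (k - l) * D ^ l"
      using card_dball[of "k - l"] l False by (intro mult_right_mono) auto
    finally show ?thesis using False by (simp add: mult.commute)
  qed
  then have "(\<Sum>l=1..k. \<Sum>z\<in>dball u (k - l). card (nbrs d F z l))
      \<le> (\<Sum>l=1..k. D ^ l * (2 * D) ^ (k - l) + (if l = k then card (nbrs d F u k) else 0))"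
    by (rule sum_mono)
  also have "\<dots> = (\<Sum>l=1..k. D ^ l * (2 * D) ^ (k - l)) + card (nbrs d F u k)"
    using k_pos by (simp add: sum.distrib del: power_mult_distrib)
  finally have "(\<Sum>l=1..k. \<Sum>z\<in>dball u (k - l). card (nbrs d F z l))
      \<le> (\<Sum>l=1..k. D ^ l * (2 * D) ^ (k - l)) + card (nbrs d F u k)" .
  moreover have "1 \<le> D ^ k" using D_pos by simp
  ultimately show ?thesis
    using card_dball_rec[of k u] sum_power_eq[of D k] by linarith
qed

lemma sum_card_nbrs:
  assumes "A \<subseteq> {1..n}"
  shows "(\<Sum>u\<in>A. card (nbrs d F u l)) \<le> 2 * card F"
proof -
  have "finite A" using assms by (rule finite_subset) simp
  then have "(\<Sum>u\<in>A. card (nbrs d F u l)) = card (SIGMA u:A. nbrs d F u l)"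
    by (intro card_SigmaI[symmetric]) auto
  also have "\<dots> \<le> card {(u, v). {u, v} \<in> F}"
    by (intro card_mono card_ordered_pairs_le finite_F) (auto simp: nbrs_def)
  also have "\<dots> \<le> 2 * card F" by (rule card_ordered_pairs_le[OF finite_F])
  finally show ?thesis .
qed

lemma card_close_pairs:
  "card {(x, y) \<in> {1..n} \<times> {1..n}. d x y \<le> k} \<le> n * (2 * D) ^ k + 2 * card F"
proof -
  have "{(x, y) \<in> {1..n} \<times> {1..n}. d x y \<le> k} = (SIGMA x:{1..n}. dball x k)"
    by (auto simp: dball_def)
  then have "card {(x, y) \<in> {1..n} \<times> {1..n}. d x y \<le> k} = (\<Sum>x\<in>{1..n}. card (dball x k))"
    by (simp add: card_SigmaI)
  also have "\<dots> \<le> (\<Sum>x\<in>{1..n}. (2 * D) ^ k + card (nbrs d F x k))"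
    by (intro sum_mono card_dball_k)
  also have "\<dots> \<le> n * (2 * D) ^ k + 2 * card F"
    using sum_card_nbrs[of "{1..n}" k] by (simp add: sum.distrib del: power_mult_distrib)
  finally show ?thesis .
qed

text \<open>Each such vertex has at least \<open>D ^ (l - 1)\<close> edges of weight
  \<open>l - 1\<close> in \<open>F\<close>, and every edge is counted at most twice.\<close>

lemma card_level_eq:
  assumes "2 \<le> l"
  shows "card {u \<in> {1..n}. level d F u = l} * D ^ (l - 1) \<le> 2 * card F"
proof -
  let ?A = "{u \<in> {1..n}. level d F u = l}"
  have "D ^ (l - 1) \<le> card (nbrs d F u (l - 1))" if "u \<in> ?A" for u
    using level_saturated[of d F u] that assms by (simp add: saturated_def)
  then have "card ?A * D ^ (l - 1) \<le> (\<Sum>u\<in>?A. card (nbrs d F u (l - 1)))"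
    using sum_bounded_below[of ?A "D ^ (l - 1)" "\<lambda>u. card (nbrs d F u (l - 1))"] by simp
  also have "\<dots> \<le> 2 * card F" by (rule sum_card_nbrs) auto
  finally show ?thesis .
qed

text \<open>If the envelope at \<open>x\<close> is at least 2, it is attained at some
  \<open>u\<close> of level \<open>l\<close> within distance \<open>l - 2\<close>. Few centres of
  level \<open>l\<close> times the size of a ball of radius \<open>l - 2\<close> leaves a factor
  \<open>1 / D\<close>, moved to the left to stay in the naturals.\<close>

lemma card_high:
  "card {x \<in> {1..n}. 2 \<le> lip_level d F x} * D \<le> k * 2 ^ k * card F"
proof -
  let ?H = "{x \<in> {1..n}. 2 \<le> lip_level d F x}"
  let ?A = "\<lambda>l. {u \<in> {1..n}. level d F u = l}"
  have "?H \<subseteq> (\<Union>l\<in>{2..k}. \<Union>u\<in>?A l. dball u (l - 2))"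
  proof
    fix x assume x: "x \<in> ?H"
    then have "1 \<le> n" by auto
    then obtain u where u: "u \<in> {1..n}" "lip_level d F x = level d F u - d u x"
      using lip_level_attained by blast
    then show "x \<in> (\<Union>l\<in>{2..k}. \<Union>u\<in>?A l. dball u (l - 2))"
      using x level_le[of d F u] by (intro UN_I[of "level d F u"] UN_I[of u]) (auto simp: dball_def)
  qed
  then have "card ?H \<le> card (\<Union>l\<in>{2..k}. \<Union>u\<in>?A l. dball u (l - 2))"
    by (intro card_mono) auto
  also have "\<dots> \<le> (\<Sum>l\<in>{2..k}. \<Sum>u\<in>?A l. card (dball u (l - 2)))"
    by (intro card_UN_le[THEN order_trans] sum_mono card_UN_le) auto
  also have "\<dots> \<le> (\<Sum>l\<in>{2..k}. \<Sum>u\<in>?A l. (2 * D) ^ (l - 2))"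
    by (intro sum_mono card_dball) (use k_pos in auto)
  finally have "card ?H * D \<le> (\<Sum>l\<in>{2..k}. card (?A l) * (2 * D) ^ (l - 2)) * D"
    by (intro mult_right_mono) auto
  also have "\<dots> = (\<Sum>l\<in>{2..k}. card (?A l) * (2 * D) ^ (l - 2) * D)"
    by (rule sum_distrib_right)
  also have "\<dots> \<le> (\<Sum>l\<in>{2..k}. 2 ^ k * card F)"
  proof (rule sum_mono)
    fix l assume l: "l \<in> {2..k}"
    then obtain j where j: "l = j + 2" by (metis add.commute atLeastAtMost_iff le_Suc_ex)
    \<comment> \<open>The ball bound and the spare factor \<open>D\<close> combine to exactly the
      power \<open>D ^ (l - 1)\<close> of \<open>card_level_eq\<close>.\<close>
    have "card (?A l) * (2 * D) ^ (l - 2) * D = 2 ^ j * (card (?A l) * D ^ (l - 1))"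
      by (simp add: j power_mult_distrib mult_ac)
    also have "\<dots> \<le> 2 ^ j * (2 * card F)"
      using card_level_eq[of l] l by (intro mult_left_mono) auto
    also have "\<dots> = 2 ^ (j + 1) * card F" by simp
    also have "\<dots> \<le> 2 ^ k * card F"
      using l j by (intro mult_right_mono power_increasing) auto
    finally show "card (?A l) * (2 * D) ^ (l - 2) * D \<le> 2 ^ k * card F" .
  qed
  also have "\<dots> \<le> k * 2 ^ k * card F" by simp
  finally show ?thesis .
qed

section \<open>The lower bound forced by the answers\<close>

text \<open>By the triangle inequality, any metric that agrees with \<open>d\<close> on
  \<open>E\<close> and is at most \<open>d\<close> elsewhere puts \<open>x\<close> and
  \<open>y\<close> at least this far apart. The inserted 0 covers empty \<open>E\<close>.\<close>

definition gap :: "nat \<Rightarrow> nat \<Rightarrow> nat" where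
  "gap x y = Max (insert 0 ((\<lambda>(u, v). d u v - d u x - d v y) ` {(u, v). {u, v} \<in> E}))"

lemma gap_ge: "{u, v} \<in> E \<Longrightarrow> d u v - d u x - d v y \<le> gap x y"
  unfolding gap_def
  by (rule Max_ge) (use card_ordered_pairs_le(1)[OF finite_E] in auto)

lemma gap_cases:
  obtains "gap x y = 0" | u v where "{u, v} \<in> E" "gap x y = d u v - d u x - d v y"
proof -
  have "gap x y \<in> insert 0 ((\<lambda>(u, v). d u v - d u x - d v y) ` {(u, v). {u, v} \<in> E})"
    unfolding gap_def by (rule Max_in) (use card_ordered_pairs_le(1)[OF finite_E] in auto)
  then show ?thesis using that by auto
qed

lemma gap_sym_le: "gap x y \<le> gap y x"
proof (cases rule: gap_cases[of x y])
  case (2 u v)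
  then show ?thesis
    using gap_ge[of v u y x] sym[of u v] by (auto simp: insert_commute)
qed simp

lemma gap_sym: "gap x y = gap y x"
  by (intro antisym gap_sym_le)

lemma gap_le: "gap x y \<le> d x y"
proof (cases rule: gap_cases[of x y])
  case (2 u v)
  then show ?thesis using tri[of u v x] tri[of x v y] sym[of v y] by linarith
qed simp

text \<open>The edge that attains \<open>gap x z\<close> is also a candidate for
  \<open>gap y z\<close>, at an extra cost of at most \<open>d x y\<close>.\<close>

lemma gap_lipschitz: "gap x z \<le> d x y + gap y z"
proof (cases rule: gap_cases[of x z])
  case (2 u v)
  then show ?thesis using gap_ge[of u v y z] tri[of u y x] by linarith
qed simp

text \<open>\<open>EL\<close> bounds the attaining edge by the envelope at \<open>u\<close> or
  \<open>v\<close>; moving to \<open>x\<close> or \<open>y\<close> loses no more than the distance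
  subtracted in \<open>gap\<close>.\<close>

lemma gap_le_lip_level:
  assumes "1 \<le> n"
  shows "gap x y \<le> max (lip_level d F x) (lip_level d F y)"
proof (cases rule: gap_cases[of x y])
  case (2 u v)
  note L = lip_level_lipschitz[where d=d and F=F, OF assms tri]
  show ?thesis using EL[OF 2(1)] 2(2) L[of u x] L[of v y] by linarith
qed simp

lemma gap_edge: "{u, v} \<in> E \<Longrightarrow> gap u v = d u v"
  using gap_ge[of u v u v] gap_le[of u v] zero[of u u] zero[of v v] by simp

text \<open>A positive gap forces \<open>d u x + d v y\<close> to be at most \<open>k - 1\<close>
  for some edge. For each split of this budget the two balls have product at most
  \<open>(2 * D) ^ (k - 1)\<close>.\<close>

lemma card_gap:
  "card {(x, y) \<in> {1..n} \<times> {1..n}. 1 \<le> gap x y} \<le> 2 * card E * (k * (2 * D) ^ (k - 1))"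
proof -
  let ?P = "{(u, v). {u, v} \<in> E}"
  let ?B = "\<lambda>p a. dball (fst p) a \<times> dball (snd p) (k - 1 - a)"
  have "{(x, y) \<in> {1..n} \<times> {1..n}. 1 \<le> gap x y} \<subseteq> (\<Union>p\<in>?P. \<Union>a\<in>{..<k}. ?B p a)"
  proof safe
    fix x y assume xy: "x \<in> {1..n}" "y \<in> {1..n}" "1 \<le> gap x y"
    then obtain u v where uv: "{u, v} \<in> E" "gap x y = d u v - d u x - d v y"
      using gap_cases[of x y] by (metis not_one_le_zero)
    then have "d u x < k" "d v y \<le> k - 1 - d u x" using E_le[OF uv(1)] xy(3) by linarith+
    then show "(x, y) \<in> (\<Union>p\<in>?P. \<Union>a\<in>{..<k}. ?B p a)"
      using uv(1) xy by (intro UN_I[of "(u, v)"] UN_I[of "d u x"]) (auto simp: dball_def)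
  qed
  then have "card {(x, y) \<in> {1..n} \<times> {1..n}. 1 \<le> gap x y} \<le> card (\<Union>p\<in>?P. \<Union>a\<in>{..<k}. ?B p a)"
    by (intro card_mono) (use card_ordered_pairs_le(1)[OF finite_E] in auto)
  also have "\<dots> \<le> (\<Sum>p\<in>?P. \<Sum>a\<in>{..<k}. card (?B p a))"
    by (intro card_UN_le[THEN order_trans] sum_mono card_UN_le card_ordered_pairs_le(1)[OF finite_E]) auto
  also have "\<dots> \<le> (\<Sum>p\<in>?P. \<Sum>a\<in>{..<k}. (2 * D) ^ (k - 1))"
  proof (intro sum_mono)
    fix p a assume a: "a \<in> {..<k}"
    have "card (?B p a) \<le> (2 * D) ^ a * (2 * D) ^ (k - 1 - a)"
      unfolding card_cartesian_product using a by (intro mult_mono card_dball) auto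
    also have "\<dots> = (2 * D) ^ (k - 1)"
      using a unfolding power_add[symmetric] by simp
    finally show "card (?B p a) \<le> (2 * D) ^ (k - 1)" .
  qed
  also have "\<dots> = card ?P * (k * (2 * D) ^ (k - 1))" by simp
  also have "\<dots> \<le> 2 * card E * (k * (2 * D) ^ (k - 1))"
    by (intro mult_right_mono card_ordered_pairs_le finite_E) simp
  finally show ?thesis .
qed

section \<open>The upper and lower metrics\<close>

text \<open>On edges \<open>gap\<close> already equals \<open>d\<close>. The shift 1/2 is the
  largest that keeps the triangle inequality for two legs not measured by \<open>d\<close>.\<close>

definition low :: "nat \<Rightarrow> nat \<Rightarrow> real" where
  "low x y = min (real (d x y))
     (max (real (gap x y)) (real (max (lip_level d F x) (lip_level d F y)) - 1 / 2))"

lemma metric_up: "metric_upto n (real k + 1) (\<lambda>x y. real (d x y))"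
proof -
  have tr: "real (d x z) \<le> real (d x y) + real (d y z)" for x y z
    using tri[of x z y] by linarith
  have le: "real (d x y) \<le> real k + 1" for x y using bnd[of x y] by linarith
  show ?thesis
    unfolding metric_upto_def
    by (auto simp: zero intro!: Metric_space.intro tr le arg_cong[OF sym])
qed

lemma metric_low: "metric_upto n (real k + 1) low"
proof -
  let ?L = "lip_level d F"
  have L1: "1 \<le> ?L x" if "x \<in> {1..n}" for x
    using lip_level_ge1 that zero by blast
  have nonneg: "0 \<le> low x y" for x y by (simp add: low_def)
  have low_sym: "low x y = low y x" for x y
    unfolding low_def by (simp add: sym[of x y] gap_sym[of x y] max.commute)
  have "low x y = 0 \<longleftrightarrow> x = y" if "x \<in> {1..n}" "y \<in> {1..n}" for x y
    using zero[of x y] L1[OF that(1)] unfolding low_def by (auto simp: min_def max_def)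
  moreover have "low x z \<le> low x y + low y z"
    if V: "x \<in> {1..n}" "y \<in> {1..n}" "z \<in> {1..n}" for x y z
  proof -
    have n1: "1 \<le> n" using V by auto
    define c where
      "c x y = max (real (gap x y)) (max (real (?L x)) (real (?L y)) - 1 / 2)" for x y
    have low: "low x y = min (real (d x y)) (c x y)" for x y
      unfolding low_def c_def by (simp add: of_nat_max)
    have c_sym: "c x y = c y x" for x y
      unfolding c_def by (simp add: gap_sym[of x y] max.commute)
    note L = lip_level_lipschitz[where d=d and F=F, OF n1 tri]
    have dc: "c x z \<le> real (d x y) + c y z" for x y z
      using gap_lipschitz[of x z y] L[of x y] unfolding c_def by linarith
    have "real (d x z) \<le> real (d x y) + real (d y z)" using tri[of x z y] by linarith
    moreover have "c x z \<le> c x y + real (d y z)"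
      using dc[of z x y] sym[of z y] c_sym[of z x] c_sym[of y x] by linarith
    \<comment> \<open>One leg is at least the envelope at \<open>x\<close> minus 1/2 and the other
      at least 1/2, because the envelope is at least 1; the same holds with \<open>z\<close> in
      place of \<open>x\<close>.\<close>
    moreover have "c x z \<le> c x y + c y z"
    proof -
      have "c x z \<le> max (real (?L x)) (real (?L z))"
        using gap_le_lip_level[OF n1, of x z] unfolding c_def by linarith
      then show ?thesis using L1[OF V(1)] L1[OF V(3)] unfolding c_def by linarith
    qed
    ultimately show ?thesis
      using dc[of x z y] unfolding low by linarith
  qed
  moreover have "low x y \<le> real k + 1" for x y
    using bnd[of x y] unfolding low_def by linarith
  ultimately show ?thesis
    unfolding metric_upto_def Metric_space_def using nonneg low_sym by simp
qed

lemma low_edge: "{u, v} \<in> E \<Longrightarrow> low u v = real (d u v)"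
  unfolding low_def by (simp add: gap_edge)

lemma low_eq_half:
  assumes "x \<in> {1..n}" "y \<in> {1..n}" "x \<noteq> y" "lip_level d F x < 2" "lip_level d F y < 2" "gap x y < 1"
  shows "low x y = 1 / 2"
proof -
  have "lip_level d F x = 1" "lip_level d F y = 1"
    using assms lip_level_ge1[of d x F] lip_level_ge1[of d y F] zero by force+
  then show ?thesis using assms zero[of x y] unfolding low_def by (simp add: min_def)
qed

text \<open>Exceptions lie on the diagonal, have an endpoint with envelope at least 2, or have a
  positive gap. The factor \<open>D\<close> lets \<open>card_high\<close> apply directly.\<close>

lemma card_low:
  "card {(x, y) \<in> {1..n} \<times> {1..n}. low x y \<noteq> 1 / 2} * D
     \<le> n * D + 2 * n * (k * 2 ^ k * card F) + 2 * card E * (k * (2 * D) ^ (k - 1)) * D"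
proof -
  let ?H = "{x \<in> {1..n}. 2 \<le> lip_level d F x}"
  let ?G = "{(x, y) \<in> {1..n} \<times> {1..n}. 1 \<le> gap x y}"
  let ?diag = "(\<lambda>x. (x, x)) ` {1..n}"
  let ?Y = "{(x, y) \<in> {1..n} \<times> {1..n}. low x y \<noteq> 1 / 2}"
  have "?Y \<subseteq> (?diag \<union> (?H \<times> {1..n} \<union> {1..n} \<times> ?H)) \<union> ?G"
    using low_eq_half by force
  moreover have "?G \<subseteq> {1..n} \<times> {1..n}" by auto
  then have "finite ?G" by (rule finite_subset) simp
  ultimately have "card ?Y \<le> card ((?diag \<union> (?H \<times> {1..n} \<union> {1..n} \<times> ?H)) \<union> ?G)"
    by (intro card_mono) auto
  also have "\<dots> \<le> (card ?diag + (card (?H \<times> {1..n}) + card ({1..n} \<times> ?H))) + card ?G"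
    by (intro card_Un_le[THEN order_trans] add_mono order_refl)
  also have "\<dots> \<le> n + 2 * n * card ?H + 2 * card E * (k * (2 * D) ^ (k - 1))"
    using card_gap card_image_le[of "{1..n}" "\<lambda>x. (x, x)"]
    unfolding card_cartesian_product by simp
  finally have "card ?Y * D \<le> (n + 2 * n * card ?H + 2 * card E * (k * (2 * D) ^ (k - 1))) * D"
    by (rule mult_right_mono) simp
  also have "\<dots> = n * D + 2 * n * (card ?H * D) + 2 * card E * (k * (2 * D) ^ (k - 1)) * D"
    by (simp add: algebra_simps)
  also have "\<dots> \<le> n * D + 2 * n * (k * 2 ^ k * card F) + 2 * card E * (k * (2 * D) ^ (k - 1)) * D"
    by (intro add_mono mult_left_mono card_high order_refl) auto
  finally show ?thesis .
qed

end

section \<open>Playing against a query procedure\<close>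

lemma (in query_game) game_state_init:
  "game_state k n D (\<lambda>x y. if x = y then 0 else k + 1) {} {}"
  by unfold_locales (auto simp: nbrs_def)

context query_game
begin

text \<open>The answers are read off the current \<open>d\<close>. A move preserves them on earlier
  pairs, so the equations for earlier queries persist although \<open>d\<close> changes.\<close>

lemma game_run:
  assumes proc: "query_procedure n m query"
  shows "j \<le> m \<Longrightarrow> \<exists>e d F. game_state k n D d F (e ` {1..j}) \<and> card F \<le> j \<and>
           (\<forall>i\<in>{1..j}. e i = query i (history e (pair_dist d) i))"
proof (induction j)
  case 0
  show ?case using game_state_init by (intro exI[of _ "\<lambda>_. {}"] exI) auto
next
  case (Suc j)
  then obtain e d F where st: "game_state k n D d F (e ` {1..j})" and F: "card F \<le> j"
    and e: "\<And>i. i \<in> {1..j} \<Longrightarrow> e i = query i (history e (pair_dist d) i)"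
    by fastforce
  interpret game_state k n D d F "e ` {1..j}" by (rule st)
  define p where "p = query (Suc j) (history e (pair_dist d) (Suc j))"
  have "length (history e (pair_dist d) (Suc j)) = Suc j - 1"
    "set (history e (pair_dist d) (Suc j)) \<subseteq> pairs_of n \<times> {0..}"
    using EV by (auto simp: history_def)
  then have p: "p \<in> pairs_of n"
    using proc Suc.prems unfolding p_def query_procedure_def Pi_iff by auto
  then obtain u v where uv: "p = {u, v}" by (auto simp: nsets_def card_2_iff)
  obtain d' F' where st': "game_state k n D d' F' (insert p (e ` {1..j}))"
    and F': "F' \<subseteq> insert p F" and agree: "\<forall>p\<in>e ` {1..j}. pair_dist d' p = pair_dist d p"
    using step[of u v] p uv by auto
  define e' where "e' = e(Suc j := p)"
  have e'_old: "e' i = e i" if "i \<in> {1..j}" for i using that by (simp add: e'_def)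
  have e'_new: "e' (Suc j) = p" by (simp add: e'_def)
  have "{1..Suc j} = insert (Suc j) {1..j}" by auto
  moreover have "e' ` {1..j} = e ` {1..j}" by (rule image_cong[OF refl e'_old])
  ultimately have "e' ` {1..Suc j} = insert p (e ` {1..j})"
    by (simp only: image_insert e'_new)
  moreover have "card F' \<le> Suc j"
  proof -
    have "card F' \<le> card (insert p F)" using F' finite_F by (intro card_mono) auto
    also have "\<dots> \<le> Suc (card F)" using finite_F by (simp add: card_insert_le_m1)
    finally show ?thesis using F by simp
  qed
  \<comment> \<open>The history before query \<open>i\<close> involves only queries below
    \<open>i\<close>, so even \<open>i = Suc j\<close> sees no new answer.\<close>
  moreover have hist: "history e' (pair_dist d') i = history e (pair_dist d) i" if "i \<le> Suc j" for i
  proof -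
    have "e' x = e x \<and> pair_dist d' (e x) = pair_dist d (e x)" if "x \<in> set [1..<i]" for x
      using that \<open>i \<le> Suc j\<close> e'_old[of x] agree by auto
    then show ?thesis unfolding history_def by (intro map_cong refl) simp
  qed
  moreover have "e' i = query i (history e' (pair_dist d') i)" if "i \<in> {1..Suc j}" for i
  proof (cases "i = Suc j")
    case True
    then show ?thesis using hist[of i] e'_new p_def by simp
  next
    case False
    then show ?thesis using that e[of i] hist[of i] e'_old[of i] by simp
  qed
  ultimately show ?case using st' by metis
qed

end

text \<open>The claim for a single \<open>n\<close>, packaged so that witnesses can be chosen for
  all \<open>n\<close> together.\<close>

definition ambiguous_run where
  "ambiguous_run k n m query e w d_up d_low X Y \<longleftrightarrow>
     query_run k m query e w \<and>
     metric_upto n (real k + 1) d_up \<and>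
     metric_upto n (real k + 1) d_low \<and>
     (\<forall>u v. {u, v} \<in> e ` {1..m} \<longrightarrow>
        d_up u v = real (w {u, v}) \<and> d_low u v = real (w {u, v})) \<and>
     X \<subseteq> {1..n} \<times> {1..n} \<and>
     (\<forall>(x, y) \<in> ({1..n} \<times> {1..n}) - X. d_up x y = real k + 1) \<and>
     Y \<subseteq> {1..n} \<times> {1..n} \<and>
     (\<forall>(x, y) \<in> ({1..n} \<times> {1..n}) - Y. d_low x y = 1 / 2)"

lemma (in query_game) ambiguous_run_exists:
  assumes proc: "query_procedure n m query"
  shows "\<exists>e w d_up d_low X Y. ambiguous_run k n m query e w d_up d_low X Y \<and>
           card X \<le> n * (2 * D) ^ k + 2 * m \<and>
           card Y * D \<le> n * D + 2 * n * (k * 2 ^ k * m) + 2 * m * (k * (2 * D) ^ (k - 1)) * D"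
proof -
  obtain e d F where st: "game_state k n D d F (e ` {1..m})" and F: "card F \<le> m"
    and e: "\<And>i. i \<in> {1..m} \<Longrightarrow> e i = query i (history e (pair_dist d) i)"
    using game_run[OF proc order_refl] by blast
  interpret game_state k n D d F "e ` {1..m}" by (rule st)
  have E: "card (e ` {1..m}) \<le> m" using card_image_le[of "{1..m}" e] by simp
  have pair: "pair_dist d {u, v} = d u v" for u v by (rule pair_dist_insert) (rule sym)
  let ?X = "{(x, y) \<in> {1..n} \<times> {1..n}. d x y \<le> k}"
  let ?Y = "{(x, y) \<in> {1..n} \<times> {1..n}. low x y \<noteq> 1 / 2}"
  have "pair_dist d (e i) \<in> {1..k}" if i: "i \<in> {1..m}" for i
  proof -
    have "e i \<in> pairs_of n" using EV i by auto
    then obtain u v where uv: "e i = {u, v}" "u \<noteq> v" by (auto simp: nsets_def card_2_iff)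
    then have "{u, v} \<in> e ` {1..m}" using i by (metis image_eqI)
    from E_le[OF this] show ?thesis using zero[of u v] uv by (simp add: pair)
  qed
  then have "query_run k m query e (pair_dist d)"
    unfolding query_run_def using e by blast
  moreover have "real (d u v) = real (pair_dist d {u, v}) \<and> low u v = real (pair_dist d {u, v})"
    if "{u, v} \<in> e ` {1..m}" for u v
    using low_edge[OF that] by (simp add: pair)
  moreover have "real (d x y) = real k + 1" if "\<not> d x y \<le> k" for x y
    using bnd[of x y] that by simp
  ultimately have "ambiguous_run k n m query e (pair_dist d) (\<lambda>x y. real (d x y)) low ?X ?Y"
    unfolding ambiguous_run_def using metric_up metric_low by blast
  moreover have "card ?X \<le> n * (2 * D) ^ k + 2 * m"
    using card_close_pairs F by linarith
  moreover have "card ?Y * D \<le> n * D + 2 * n * (k * 2 ^ k * m) + 2 * m * (k * (2 * D) ^ (k - 1)) * D"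
    by (rule card_low[THEN order_trans]) (intro add_mono mult_mono F E order_refl; simp)
  ultimately show ?thesis by blast
qed

section \<open>Asymptotics and the choice of \<open>D\<close>\<close>

lemma smallo_square_if_le:
  fixes c :: "nat \<Rightarrow> nat" and b :: "nat \<Rightarrow> real"
  assumes "\<And>n. 1 \<le> n \<Longrightarrow> real (c n) \<le> (real n)\<^sup>2 * b n" and "b \<longlonglongrightarrow> 0"
  shows "(\<lambda>n. real (c n)) \<in> o(\<lambda>n. (real n)\<^sup>2)"
proof (rule smalloI_tendsto)
  show "(\<lambda>n. real (c n) / (real n)\<^sup>2) \<longlonglongrightarrow> 0"
  proof (rule tendsto_sandwich[OF _ _ tendsto_const assms(2)])
    show "\<forall>\<^sub>F n in sequentially. real (c n) / (real n)\<^sup>2 \<le> b n"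
      using eventually_ge_at_top[of 1] by eventually_elim (use assms(1) in \<open>simp add: divide_simps mult.commute\<close>)
  qed simp
  show "\<forall>\<^sub>F n in sequentially. (real n)\<^sup>2 \<noteq> 0"
    using eventually_gt_at_top[of 0] by eventually_elim simp
qed

text \<open>With \<open>q\<close> the \<open>k\<close>-th root of \<open>n\<close>,
  \<open>m / (n * q)\<close> tends to 0. Its square root \<open>s\<close> shares this smallness
  between both demands: for \<open>D\<close> about \<open>s * q\<close>, \<open>m\<close> is about
  \<open>s * n * D\<close> and \<open>D ^ k\<close> about \<open>s ^ k * n\<close>.\<close>

lemma degree_parameter:
  fixes m :: "nat \<Rightarrow> nat"
  assumes k: "1 \<le> k" and m: "(\<lambda>n. real (m n)) \<in> o(\<lambda>n. real n powr ((real k + 1) / real k))"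
  obtains D :: "nat \<Rightarrow> nat" and s t :: "nat \<Rightarrow> real"
  where "\<And>n. 1 \<le> D n" "s \<longlonglongrightarrow> 0" "t \<longlonglongrightarrow> 0" "\<And>n. 0 \<le> s n"
    "\<And>n. 1 \<le> n \<Longrightarrow> real (m n) \<le> s n * real n * real (D n)"
    "\<And>n. 1 \<le> n \<Longrightarrow> (2 * real (D n)) ^ k \<le> t n * real n"
proof -
  define q where "q n = real n powr (1 / real k)" for n
  define s where "s n = sqrt (real (m n) / (real n * q n))" for n
  \<comment> \<open>Rounding up and the successor cost at most 2, which yields the summand 4 in the
    bound for \<open>2 * D\<close> and, after division by \<open>q\<close>, the first term of
    \<open>t\<close>.\<close>
  define D where "D n = Suc (nat \<lceil>s n * q n\<rceil>)" for n
  define t where "t n = (4 * (real n powr (- (1 / real k))) + 2 * s n) ^ k" for n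
  have q: "q n ^ k = real n" "0 < q n" if "1 \<le> n" for n
    using that k by (simp_all add: q_def powr_realpow[symmetric] powr_powr)
  have "(\<lambda>n. real (m n) / (real n powr ((real k + 1) / real k))) \<longlonglongrightarrow> 0"
    using m by (rule smalloD_tendsto)
  moreover have "real n powr ((real k + 1) / real k) = real n * q n" for n
    using k by (cases "n = 0") (simp_all add: q_def add_divide_distrib powr_add)
  ultimately have "(\<lambda>n. real (m n) / (real n * q n)) \<longlonglongrightarrow> 0" by simp
  then have s0: "s \<longlonglongrightarrow> 0" unfolding s_def using tendsto_real_sqrt by fastforce
  have "(\<lambda>n. real n powr (- (1 / real k))) \<longlonglongrightarrow> 0"
    using k by (intro tendsto_neg_powr filterlim_real_sequentially) auto
  from tendsto_add[OF tendsto_mult[OF tendsto_const[of 4] this] tendsto_mult[OF tendsto_const[of 2] s0]]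
  have "(\<lambda>n. 4 * (real n powr (- (1 / real k))) + 2 * s n) \<longlonglongrightarrow> 0" by simp
  from tendsto_power[OF this, of k] have t0: "t \<longlonglongrightarrow> 0"
    unfolding t_def using k by (simp only: zero_power)
  have s_nonneg: "0 \<le> s n" for n by (simp add: s_def q_def)
  have D_ge: "s n * q n \<le> real (D n)" for n unfolding D_def by linarith
  have D_le: "real (D n) \<le> 2 + s n * q n" for n
  proof -
    have "0 \<le> s n * q n" using s_nonneg by (simp add: q_def)
    then show ?thesis unfolding D_def by linarith
  qed
  have "real (m n) \<le> s n * real n * real (D n)" if n: "1 \<le> n" for n
  proof -
    have "(s n)\<^sup>2 = real (m n) / (real n * q n)" unfolding s_def by (simp add: q_def)
    then have "real (m n) = s n * real n * (s n * q n)"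
      using n q(2)[OF n] by (simp add: field_simps power2_eq_square)
    also have "\<dots> \<le> s n * real n * real (D n)"
      using D_ge s_nonneg by (intro mult_left_mono) auto
    finally show ?thesis .
  qed
  moreover have "(2 * real (D n)) ^ k \<le> t n * real n" if n: "1 \<le> n" for n
  proof -
    have "real n powr (- (1 / real k)) * q n = 1"
      using n by (simp add: q_def powr_minus)
    then have "(4 * (real n powr (- (1 / real k))) + 2 * s n) * q n = 4 + 2 * (s n * q n)"
      by (simp add: algebra_simps)
    then have "2 * real (D n) \<le> (4 * (real n powr (- (1 / real k))) + 2 * s n) * q n"
      using D_le[of n] by simp
    then have "(2 * real (D n)) ^ k \<le> ((4 * (real n powr (- (1 / real k))) + 2 * s n) * q n) ^ k"
      by (intro power_mono) auto
    then show ?thesis by (simp add: power_mult_distrib t_def q(1)[OF n])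
  qed
  ultimately show ?thesis using that[of D s t] s0 t0 s_nonneg by (simp add: D_def)
qed

theorem theorem7p4:
  fixes k :: nat
    and m :: "nat \<Rightarrow> nat"
    and query :: "nat \<Rightarrow> nat \<Rightarrow> (nat set \<times> real) list \<Rightarrow> nat set"
  assumes "k \<ge> 1"
    and "\<And>n. n \<ge> 1 \<Longrightarrow> query_procedure n (m n) (query n)"
    and "(\<lambda>n. real (m n)) \<in> o(\<lambda>n. real n powr ((real k + 1) / real k))"
  shows "\<exists>(e :: nat \<Rightarrow> nat \<Rightarrow> nat set) (w :: nat \<Rightarrow> nat set \<Rightarrow> nat)
           (d_up :: nat \<Rightarrow> nat \<Rightarrow> nat \<Rightarrow> real) (d_low :: nat \<Rightarrow> nat \<Rightarrow> nat \<Rightarrow> real)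
           (X :: nat \<Rightarrow> (nat \<times> nat) set) (Y :: nat \<Rightarrow> (nat \<times> nat) set).
           (\<forall>n\<ge>1.
              query_run k (m n) (query n) (e n) (w n) \<and>
              metric_upto n (real k + 1) (d_up n) \<and>
              metric_upto n (real k + 1) (d_low n) \<and>
              (\<forall>u v. {u, v} \<in> e n ` {1..m n} \<longrightarrow>
                 d_up n u v = real (w n {u, v}) \<and> d_low n u v = real (w n {u, v})) \<and>
              X n \<subseteq> {1..n} \<times> {1..n} \<and>
              (\<forall>(x, y) \<in> ({1..n} \<times> {1..n}) - X n. d_up n x y = real k + 1) \<and>
              Y n \<subseteq> {1..n} \<times> {1..n} \<and>
              (\<forall>(x, y) \<in> ({1..n} \<times> {1..n}) - Y n. d_low n x y = 1 / 2)) \<and>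
           (\<lambda>n. real (card (X n))) \<in> o(\<lambda>n. (real n)\<^sup>2) \<and>
           (\<lambda>n. real (card (Y n))) \<in> o(\<lambda>n. (real n)\<^sup>2)"
proof -
  obtain D s t where D1: "\<And>n. 1 \<le> D n" and s0: "s \<longlonglongrightarrow> 0" and t0: "t \<longlonglongrightarrow> 0"
    and s_nonneg: "\<And>n. 0 \<le> s n"
    and mD: "\<And>n. 1 \<le> n \<Longrightarrow> real (m n) \<le> s n * real n * real (D n)"
    and Dk: "\<And>n. 1 \<le> n \<Longrightarrow> (2 * real (D n)) ^ k \<le> t n * real n"
    using degree_parameter[OF assms(1) assms(3)] by metis
  have "\<exists>e w d_up d_low X Y. ambiguous_run k n (m n) (query n) e w d_up d_low X Y \<and>
           card X \<le> n * (2 * D n) ^ k + 2 * m n \<and>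
           card Y * D n \<le> n * D n + 2 * n * (k * 2 ^ k * m n) + 2 * m n * (k * (2 * D n) ^ (k - 1)) * D n"
    if "1 \<le> n" for n
    using query_game.ambiguous_run_exists[OF query_game.intro[OF assms(1) D1] assms(2)[OF that]] .
  then obtain e w d_up d_low X Y where
    run: "\<And>n. 1 \<le> n \<Longrightarrow> ambiguous_run k n (m n) (query n) (e n) (w n) (d_up n) (d_low n) (X n) (Y n)"
    and X: "\<And>n. 1 \<le> n \<Longrightarrow> card (X n) \<le> n * (2 * D n) ^ k + 2 * m n"
    and Y: "\<And>n. 1 \<le> n \<Longrightarrow> card (Y n) * D n
              \<le> n * D n + 2 * n * (k * 2 ^ k * m n) + 2 * m n * (k * (2 * D n) ^ (k - 1)) * D n"
    by metis
  have D_le: "real (D n) \<le> t n * real n" if n: "1 \<le> n" for n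
  proof -
    have "real (D n) \<le> 2 * real (D n)" by simp
    also have "\<dots> \<le> (2 * real (D n)) ^ k"
      using D1[of n] assms(1) by (intro self_le_power) auto
    finally show ?thesis using Dk[OF n] by simp
  qed
  have "(\<lambda>n. real (card (X n))) \<in> o(\<lambda>n. (real n)\<^sup>2)"
  proof (rule smallo_square_if_le[where b = "\<lambda>n. t n + 2 * s n * t n"])
    fix n :: nat assume n: "1 \<le> n"
    have "real (card (X n)) \<le> real n * (2 * real (D n)) ^ k + 2 * real (m n)"
      using X[OF n] by (metis (mono_tags) of_nat_le_iff of_nat_add of_nat_mult of_nat_power of_nat_numeral)
    also have "\<dots> \<le> real n * (t n * real n) + 2 * (s n * real n * (t n * real n))"
      using Dk[OF n] mD[OF n] D_le[OF n] s_nonneg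
      by (intro add_mono mult_left_mono order_trans[OF mD[OF n]]) auto
    also have "\<dots> = (real n)\<^sup>2 * (t n + 2 * s n * t n)"
      by (simp add: algebra_simps power2_eq_square)
    finally show "real (card (X n)) \<le> (real n)\<^sup>2 * (t n + 2 * s n * t n)" .
  next
    show "(\<lambda>n. t n + 2 * s n * t n) \<longlonglongrightarrow> 0" 
      using tendsto_add[OF t0 tendsto_mult[OF tendsto_mult[OF tendsto_const[of 2] s0] t0]] by simp
  qed
  moreover have "(\<lambda>n. real (card (Y n))) \<in> o(\<lambda>n. (real n)\<^sup>2)"
  proof (rule smallo_square_if_le[where b = "\<lambda>n. 1 / real n + 2 * (real k * 2 ^ k) * s n + 2 * real k * s n * t n"])
    fix n :: nat assume n: "1 \<le> n"
    let ?C = "real k * 2 ^ k"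
    \<comment> \<open>The diagonal term \<open>n * D\<close> becomes \<open>n ^ 2 * r * D\<close>;
      naming \<open>r\<close> keeps the later algebra free of division.\<close>
    define r where "r = 1 / real n"
    have D0: "0 < real (D n)" using D1[of n] by simp
    \<comment> \<open>The factor \<open>D\<close> that multiplies the gap bound is absorbed into the
      power, so that \<open>Dk\<close> applies.\<close>
    have k': "(2 * real (D n)) ^ (k - 1) * real (D n) \<le> (2 * real (D n)) ^ k"
      using assms(1) by (cases k) auto
    have "real (card (Y n)) * real (D n) \<le> real n * real (D n) + 2 * real n * (?C * real (m n)) +
            2 * real (m n) * (real k * ((2 * real (D n)) ^ (k - 1) * real (D n)))"
      using Y[OF n, THEN of_nat_mono[where 'a = real]] by (simp add: mult_ac)
    also have "\<dots> \<le> real n * real (D n) + 2 * real n * (?C * (s n * real n * real (D n))) +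
            2 * (s n * real n * real (D n)) * (real k * (t n * real n))"
    proof -
      have "?C * real (m n) \<le> ?C * (s n * real n * real (D n))"
        by (rule mult_left_mono[OF mD[OF n]]) simp
      moreover have "2 * real (m n) * (real k * ((2 * real (D n)) ^ (k - 1) * real (D n)))
          \<le> 2 * (s n * real n * real (D n)) * (real k * (t n * real n))"
        by (rule mult_mono[OF mult_left_mono[OF mD[OF n]] mult_left_mono[OF order_trans[OF k' Dk[OF n]]]])
          (use s_nonneg in auto)
      ultimately show ?thesis
        using mult_left_mono[of "?C * real (m n)" "?C * (s n * real n * real (D n))" "2 * real n"]
        by linarith
    qed
    also have "\<dots> = ((real n)\<^sup>2 * (r + 2 * ?C * s n + 2 * real k * s n * t n)) * real (D n)"
    proof -
      have "real n * real (D n) = (real n)\<^sup>2 * r * real (D n)"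
        using n by (simp add: r_def power2_eq_square)
      then show ?thesis by (simp add: algebra_simps power2_eq_square)
    qed
    finally show "real (card (Y n)) \<le> (real n)\<^sup>2 * (1 / real n + 2 * ?C * s n + 2 * real k * s n * t n)"
      unfolding r_def[symmetric]
      using D0 mult_le_cancel_right_pos by blast
  next
    show "(\<lambda>n. 1 / real n + 2 * (real k * 2 ^ k) * s n + 2 * real k * s n * t n) \<longlonglongrightarrow> 0"
      using tendsto_add[OF tendsto_add[OF lim_1_over_n tendsto_mult[OF tendsto_const[of "2 * (real k * 2 ^ k)"] s0]]
          tendsto_mult[OF tendsto_mult[OF tendsto_const[of "2 * real k"] s0] t0]] by simp
  qed
  ultimately show ?thesis
    using run unfolding ambiguous_run_def by blast
qed

end
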